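(* There exists an abelian subgroup of $\mathrm{Aut}(\mathbb{U})$ of infinite exponent that acts transitively on $\mathbb{U}$.
   Context: $\mathbb{U}$ denotes the Urysohn space: the complete separable metric space, unique up to isometry, that is homogeneous (any isometry between finite subsets extends to an isometry of $\mathbb{U}$ onto itself) and universal (every complete separable metric space embeds isometrically in it). $\mathrm{Aut}(\mathbb{U})$ is the group of all isometries of $\mathbb{U}$ onto itself. A group has infinite exponent if there is no positive integer $n$ with $g^n=1$ for all elements $g$ of the group. *)

theory Defs
  imports "HOL-Analysis.Abstract_Metric_Spaces" "HOL-Algebra.Group_Action"
begin

definition isometry :: "'a metric \<Rightarrow> 'b metric \<Rightarrow> ('a \<Rightarrow> 'b) \<Rightarrow> bool" where
  "isometry X Y f \<longleftrightarrow>
     bij_betw f (mspace X) (mspace Y) \<and>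
     (\<forall>x\<in>mspace X. \<forall>y\<in>mspace X. mdist Y (f x) (f y) = mdist X x y)"

definition isometrically_embeds :: "'a metric \<Rightarrow> 'b metric \<Rightarrow> bool" where
  "isometrically_embeds X Y \<longleftrightarrow> (\<exists>S f. S \<subseteq> mspace Y \<and> isometry X (submetric Y S) f)"

definition polish_metric :: "'a metric \<Rightarrow> bool" where
  "polish_metric X \<longleftrightarrow> mcomplete_of X \<and> separable_space (mtopology_of X)"

definition homogeneous_metric :: "'a metric \<Rightarrow> bool" where
  "homogeneous_metric X \<longleftrightarrow>
     (\<forall>A B f. finite A \<and> A \<subseteq> mspace X \<and> finite B \<and> B \<subseteq> mspace X
        \<and> isometry (submetric X A) (submetric X B) f
        \<longrightarrow> (\<exists>g. isometry X X g \<and> (\<forall>x\<in>A. g x = f x)))"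

text \<open>
  Types cannot be quantified inside a definition, so universality is stated for spaces whose
  points are real numbers. A separable metric space has at most continuum many points, so this
  covers all complete separable metric spaces up to isometry: see
  \<open>universal_metric_embeds\<close> below.
\<close>

definition universal_metric :: "'a metric \<Rightarrow> bool" where
  "universal_metric X \<longleftrightarrow> (\<forall>Y :: real metric. polish_metric Y \<longrightarrow> isometrically_embeds Y X)"

definition urysohn_space :: "'a metric \<Rightarrow> bool" where
  "urysohn_space X \<longleftrightarrow> polish_metric X \<and> homogeneous_metric X \<and> universal_metric X"

text \<open>
  As for \<^const>\<open>Bij\<close>, isometries are taken to be \<^const>\<open>extensional\<close>, so that
  each one is represented by exactly one HOL function.
\<close>

definition isometry_group :: "'a metric \<Rightarrow> ('a \<Rightarrow> 'a) monoid" where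
  "isometry_group X =
     BijGroup (mspace X) \<lparr>carrier := {f \<in> extensional (mspace X). isometry X X f}\<rparr>"

definition infinite_exponent :: "('a, 'b) monoid_scheme \<Rightarrow> bool" where
  "infinite_exponent G \<longleftrightarrow>
     \<not> (\<exists>n::nat. n > 0 \<and> (\<forall>g\<in>carrier G. g [^]\<^bsub>G\<^esub> n = \<one>\<^bsub>G\<^esub>))"

lemma subgroup_isometries:
  "subgroup {f \<in> extensional (mspace X). isometry X X f} (BijGroup (mspace X))"
proof (rule group.subgroupI[OF group_BijGroup])
  let ?I = "{f \<in> extensional (mspace X). isometry X X f}"
  show sub: "?I \<subseteq> carrier (BijGroup (mspace X))"
    by (auto simp: BijGroup_def Bij_def isometry_def)
  show "?I \<noteq> {}"
  proof -
    have "(\<lambda>x\<in>mspace X. x) \<in> ?I"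
      by (auto simp: isometry_def bij_betw_def inj_on_def)
    then show ?thesis by blast
  qed
  show "inv\<^bsub>BijGroup (mspace X)\<^esub> f \<in> ?I" if "f \<in> ?I" for f
  proof -
    have f: "f \<in> Bij (mspace X)" "isometry X X f"
      using that by (auto simp: Bij_def isometry_def)
    then have b: "bij_betw f (mspace X) (mspace X)"
      by (simp add: isometry_def)
    have "bij_betw (restrict (inv_into (mspace X) f) (mspace X)) (mspace X) (mspace X)"
      using restrict_inv_into_Bij[OF f(1)] by (simp add: Bij_def)
    moreover have "mdist X (inv_into (mspace X) f x) (inv_into (mspace X) f y) = mdist X x y"
      if "x \<in> mspace X" "y \<in> mspace X" for x y
    proof -
      have "inv_into (mspace X) f x \<in> mspace X" "inv_into (mspace X) f y \<in> mspace X"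
        using b that by (auto simp: bij_betw_def inv_into_into)
      then have "mdist X (f (inv_into (mspace X) f x)) (f (inv_into (mspace X) f y))
          = mdist X (inv_into (mspace X) f x) (inv_into (mspace X) f y)"
        using f(2) by (simp add: isometry_def)
      then show ?thesis
        using that b by (simp add: bij_betw_inv_into_right)
    qed
    ultimately show ?thesis
      by (simp add: inv_BijGroup[OF f(1)] isometry_def)
  qed
  show "f \<otimes>\<^bsub>BijGroup (mspace X)\<^esub> g \<in> ?I" if "f \<in> ?I" "g \<in> ?I" for f g
  proof -
    have B: "f \<in> Bij (mspace X)" "g \<in> Bij (mspace X)"
      using that by (auto simp: Bij_def isometry_def)
    have "compose (mspace X) f g \<in> Bij (mspace X)"
      using B by (rule compose_Bij)
    moreover have "g x \<in> mspace X" if "x \<in> mspace X" for x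
      using B(2) that Bij_imp_funcset by fastforce
    ultimately show ?thesis
      using that B by (auto simp: BijGroup_def Bij_def isometry_def compose_def)
  qed
qed

lemma group_isometry_group: "group (isometry_group X)"
  unfolding isometry_group_def
  by (rule group.subgroup_imp_group[OF group_BijGroup subgroup_isometries])

lemma separable_metric_lepoll_real:
  fixes X :: "'b metric"
  assumes "separable_space (mtopology_of X)"
  shows "mspace X \<lesssim> (UNIV :: real set)"
proof -
  interpret Metric_space "mspace X" "mdist X" by simp
  obtain C where C: "countable C" "C \<subseteq> mspace X" "mtopology closure_of C = mspace X"
    using assms by (auto simp: separable_space_def mtopology_of_def)
  define e where "e = (\<lambda>x. to_nat_on (C \<times> (\<rat>::real set)) ` {(c,q). c \<in> C \<and> q \<in> \<rat> \<and> mdist X x c < q})"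
  have inj: "inj_on (to_nat_on (C \<times> (\<rat>::real set))) (C \<times> \<rat>)"
    using C(1) by (intro inj_on_to_nat_on countable_SIGMA) (auto simp: countable_rat)
  have "inj_on e (mspace X)"
  proof (rule inj_onI, rule ccontr)
    fix x y assume x: "x \<in> mspace X" and y: "y \<in> mspace X" and eq: "e x = e y" and ne: "x \<noteq> y"
    have "{(c,q). c \<in> C \<and> q \<in> (\<rat>::real set) \<and> mdist X x c < q} =
          {(c,q). c \<in> C \<and> q \<in> \<rat> \<and> mdist X y c < q}"
      using eq unfolding e_def by (subst (asm) inj_on_image_eq_iff[OF inj]) auto
    then have same: "mdist X x c < q \<longleftrightarrow> mdist X y c < q" if "c \<in> C" "q \<in> \<rat>" for c q
      using that by blast
    define r where "r = mdist X x y / 2"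
    have r: "r > 0" using x y ne by (simp add: r_def)
    obtain q where q: "q \<in> \<rat>" "0 < q" "q < r" using Rats_dense_in_real[OF r] by blast
    have "x \<in> mtopology closure_of C" using C x by simp
    then obtain c where c: "c \<in> C" "mdist X x c < q"
      using q by (auto simp: metric_closure_of)
    then have "mdist X y c < q" using same q by blast
    then have "mdist X x y < 2 * r"
      using c q triangle'[of x c y] x y C by fastforce
    then show False by (simp add: r_def)
  qed
  then have "mspace X \<lesssim> (UNIV :: nat set set)"
    unfolding lepoll_def by blast
  then show ?thesis
    using lepoll_trans2 nat_sets_eqpoll_reals by blast
qed

lemma isometry_imp_polish_metric:
  assumes f: "isometry X Y f" and X: "polish_metric X"
  shows "polish_metric Y"
proof -
  interpret Metric_space12 "mspace X" "mdist X" "mspace Y" "mdist Y"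
    by (simp add: Metric_space12_mspace_mdist)
  have bij: "bij_betw f (mspace X) (mspace Y)"
    and d: "\<And>x y. \<lbrakk>x \<in> mspace X; y \<in> mspace X\<rbrakk> \<Longrightarrow> mdist Y (f x) (f y) = mdist X x y"
    using f by (auto simp: isometry_def)
  have hom: "homeomorphic_map (mtopology_of X) (mtopology_of Y) f"
    unfolding mtopology_of_def
    by (rule isometry_imp_homeomorphic_map) (use bij d in \<open>auto simp: bij_betw_def\<close>)
  then have "separable_space (mtopology_of Y)"
    using X homeomorphic_map_imp_homeomorphic_space homeomorphic_separable_space
    by (metis polish_metric_def)
  moreover have "M2.mcomplete"
    unfolding M2.mcomplete_def
  proof (intro allI impI)
    fix \<sigma> assume s: "M2.MCauchy \<sigma>"
    define g where "g = inv_into (mspace X) f"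
    have sY: "\<And>n. \<sigma> n \<in> mspace Y" using s by (auto simp: M2.MCauchy_def)
    have g: "g y \<in> mspace X" "f (g y) = y" if "y \<in> mspace Y" for y
      using that bij by (auto simp: g_def bij_betw_def f_inv_into_f inv_into_into)
    have "M1.MCauchy (g \<circ> \<sigma>)"
    proof -
      have "mdist X (g (\<sigma> m)) (g (\<sigma> n)) = mdist Y (\<sigma> m) (\<sigma> n)" for m n
        using d[of "g (\<sigma> m)" "g (\<sigma> n)"] g sY by simp
      then show ?thesis
        using s g sY unfolding M1.MCauchy_def M2.MCauchy_def by auto
    qed
    then obtain x where x: "limitin M1.mtopology (g \<circ> \<sigma>) x sequentially"
      using X by (auto simp: polish_metric_def mcomplete_of_def M1.mcomplete_def)
    have "limitin M2.mtopology (f \<circ> (g \<circ> \<sigma>)) (f x) sequentially"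
      using continuous_map_limit[OF homeomorphic_imp_continuous_map[OF hom]] x
      by (simp add: mtopology_of_def)
    moreover have "f \<circ> (g \<circ> \<sigma>) = \<sigma>" using g sY by auto
    ultimately show "\<exists>x. limitin M2.mtopology \<sigma> x sequentially" by auto
  qed
  ultimately show ?thesis by (simp add: polish_metric_def mcomplete_of_def)
qed

lemma universal_metric_embeds:
  fixes X :: "'a metric" and Y :: "'b metric"
  assumes "universal_metric X" and "polish_metric Y"
  shows "isometrically_embeds Y X"
proof -
  obtain j :: "'b \<Rightarrow> real" where j: "inj_on j (mspace Y)"
    using separable_metric_lepoll_real assms(2) by (auto simp: polish_metric_def lepoll_def)
  define h where "h = inv_into (mspace Y) j"
  have h: "h (j y) = y" if "y \<in> mspace Y" for y
    using that j by (simp add: h_def)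
  have M: "Metric_space (j ` mspace Y) (\<lambda>a b. mdist Y (h a) (h b))"
    by (unfold_locales) (auto simp: h mdist_commute mdist_triangle)
  define Z where "Z = metric (j ` mspace Y, \<lambda>a b. mdist Y (h a) (h b))"
  have Z: "mspace Z = j ` mspace Y" "mdist Z = (\<lambda>a b. mdist Y (h a) (h b))"
    using M by (simp_all add: Z_def Metric_space.mspace_metric Metric_space.mdist_metric)
  have iso: "isometry Y Z j"
    using j by (simp add: isometry_def Z h bij_betw_def)
  then have "polish_metric Z" using assms(2) isometry_imp_polish_metric by blast
  then obtain S f where S: "S \<subseteq> mspace X" "isometry Z (submetric X S) f"
    using assms(1) by (auto simp: universal_metric_def isometrically_embeds_def)
  have "isometry Y (submetric X S) (f \<circ> j)"
    using iso S(2) unfolding isometry_def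
    by (auto intro: bij_betw_trans simp: bij_betw_apply)
  then show ?thesis using S(1) unfolding isometrically_embeds_def by blast
qed

end

theory Submission
  imports Defs "HOL-Computational_Algebra.Polynomial"
begin

text \<open>
  A map \<open>\<phi>\<close> from a countable abelian group \<open>A\<close> onto a dense subset of \<open>U\<close> for which the distance of
  \<open>\<phi> x\<close> and \<open>\<phi> y\<close> depends only on \<open>x - y\<close> makes \<open>U\<close> an abelian group by completion. Its translations
  are isometries, and they form an abelian group that acts transitively.

  For \<open>A\<close> we take the free abelian group on \<open>1, X, X\<^sup>2, \<dots>\<close>, the additive group of integer polynomials.
  The norm \<open>N (x - y)\<close> and the map \<open>\<phi>\<close> are built together. At stage \<open>n\<close> the norm is defined on the
  polynomials of degree less than \<open>n\<close>, but \<open>\<phi>\<close> only on a finite subset \<open>F\<close> of them. The generator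
  \<open>X\<^sup>n\<close> is sent to a prescribed point \<open>u\<close> of \<open>U\<close>: the distances from \<open>u\<close> to \<open>\<phi> F\<close> form a Katetov function,
  and the norm extends to the next group in such a way that \<open>N (X\<^sup>n - x)\<close> is the distance from \<open>u\<close> to
  \<open>\<phi> x\<close>. Since \<open>F\<close> is finite, homogeneity and universality of \<open>U\<close> extend \<open>\<phi>\<close> to further
  elements.
\<close>

section \<open>Norms on abelian groups\<close>

definition additive_subgroup :: "'a::ab_group_add set \<Rightarrow> bool" where
  "additive_subgroup P \<longleftrightarrow> 0 \<in> P \<and> (\<forall>x\<in>P. \<forall>y\<in>P. x - y \<in> P)"

definition group_norm :: "'a::ab_group_add set \<Rightarrow> ('a \<Rightarrow> real) \<Rightarrow> bool" where
  "group_norm P N \<longleftrightarrow>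
     N 0 = 0 \<and> (\<forall>x\<in>P. x \<noteq> 0 \<longrightarrow> 0 < N x) \<and> (\<forall>x\<in>P. \<forall>y\<in>P. N (x - y) \<le> N x + N y)"

text \<open>If \<open>P\<close> carries the distance \<open>N (x - y)\<close>, these are the
  triangle inequalities for one further point at distance \<open>f x\<close> from each
  \<open>x\<close>.\<close>

definition katetov :: "'a::ab_group_add set \<Rightarrow> ('a \<Rightarrow> real) \<Rightarrow> ('a \<Rightarrow> real) \<Rightarrow> bool" where
  "katetov P N f \<longleftrightarrow> (\<forall>x\<in>P. \<forall>y\<in>P. f x \<le> f y + N (x - y) \<and> N (x - y) \<le> f x + f y)"

lemma additive_subgroup_closed:
  assumes "additive_subgroup P"
  shows "0 \<in> P" and "\<lbrakk>x \<in> P; y \<in> P\<rbrakk> \<Longrightarrow> x - y \<in> P"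
    and "x \<in> P \<Longrightarrow> - x \<in> P" and "\<lbrakk>x \<in> P; y \<in> P\<rbrakk> \<Longrightarrow> x + y \<in> P"
proof -
  show 0: "0 \<in> P" and d: "\<And>x y. \<lbrakk>x \<in> P; y \<in> P\<rbrakk> \<Longrightarrow> x - y \<in> P"
    using assms by (auto simp: additive_subgroup_def)
  have n: "- x \<in> P" if "x \<in> P" for x
    using d[OF 0 that] by simp
  then show "x \<in> P \<Longrightarrow> - x \<in> P" .
  show "x + y \<in> P" if "x \<in> P" "y \<in> P"
    using d[OF that(1) n[OF that(2)]] by simp
qed

lemma additive_subgroup_sum_list:
  assumes "additive_subgroup P" and "set xs \<subseteq> P"
  shows "sum_list xs \<in> P"
  using assms(2) by (induction xs) (auto intro: additive_subgroup_closed[OF assms(1)])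

lemma group_norm_props:
  assumes P: "additive_subgroup P" and N: "group_norm P N"
  shows "x \<in> P \<Longrightarrow> N (- x) = N x" and "x \<in> P \<Longrightarrow> 0 \<le> N x"
    and "\<lbrakk>x \<in> P; y \<in> P\<rbrakk> \<Longrightarrow> N (x + y) \<le> N x + N y"
    and "\<lbrakk>x \<in> P; y \<in> P\<rbrakk> \<Longrightarrow> N (x - y) = N (y - x)"
    and "\<lbrakk>x \<in> P; y \<in> P; z \<in> P\<rbrakk> \<Longrightarrow> N (x - z) \<le> N (x - y) + N (y - z)"
proof -
  note cl = additive_subgroup_closed[OF P]
  have d: "N (x - y) \<le> N x + N y" if "x \<in> P" "y \<in> P" for x y
    using N that by (auto simp: group_norm_def)
  have N0: "N 0 = 0" using N by (simp add: group_norm_def)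
  have le: "N (- x) \<le> N x" if "x \<in> P" for x
    using d[OF cl(1) that] N0 by simp
  then show m: "N (- x) = N x" if "x \<in> P" for x
    using le[OF that] le[OF cl(3)[OF that]] by simp
  show "x \<in> P \<Longrightarrow> 0 \<le> N x"
    using N by (cases "x = 0") (auto simp: group_norm_def less_imp_le)
  have p: "N (x + y) \<le> N x + N y" if "x \<in> P" "y \<in> P" for x y
    using d[OF that(1) cl(3)[OF that(2)]] m[OF that(2)] by simp
  then show "\<lbrakk>x \<in> P; y \<in> P\<rbrakk> \<Longrightarrow> N (x + y) \<le> N x + N y" .
  show "N (x - y) = N (y - x)" if "x \<in> P" "y \<in> P"
    using m[OF cl(2)[OF that]] by simp
  show "N (x - z) \<le> N (x - y) + N (y - z)" if "x \<in> P" "y \<in> P" "z \<in> P"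
    using p[of "x - y" "y - z"] cl(2) that by simp
qed

text \<open>In an abelian group a word in elements of \<open>P\<close> and letters
  \<open>g - x\<close> can be sorted. The elements of \<open>P\<close> merge into one
  \<open>y\<close>, which by subadditivity does not raise the cost; \<open>xs\<close> and
  \<open>ys\<close> hold the letters of either sign, with repetition.\<close>

definition word_costs ::
    "'a::ab_group_add set \<Rightarrow> ('a \<Rightarrow> real) \<Rightarrow> ('a \<Rightarrow> real) \<Rightarrow> 'a \<Rightarrow> 'a \<Rightarrow> real set" where
  "word_costs P N f g z =
     {N y + (\<Sum>x\<leftarrow>xs. f x) + (\<Sum>x\<leftarrow>ys. f x) | y xs ys.
        y \<in> P \<and> set xs \<subseteq> P \<and> set ys \<subseteq> P \<and>
        z = y + (\<Sum>x\<leftarrow>xs. g - x) - (\<Sum>x\<leftarrow>ys. g - x)}"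

text \<open>Entries in the same position are paired. A pair satisfies
  \<open>N (y - x) \<le> f y + f x\<close>, and subadditivity of \<open>N\<close> adds the pairs
  up.\<close>

lemma katetov_balanced:
  assumes P: "additive_subgroup P" and N: "group_norm P N" and f: "katetov P N f"
    and "length xs = length ys" and "set xs \<subseteq> P" and "set ys \<subseteq> P"
  shows "N (sum_list ys - sum_list xs) \<le> (\<Sum>x\<leftarrow>xs. f x) + (\<Sum>x\<leftarrow>ys. f x)"
  using assms(4-6)
proof (induction rule: list_induct2)
  case Nil
  then show ?case using N by (simp add: group_norm_def)
next
  case (Cons x xs y ys)
  have "sum_list xs \<in> P" "sum_list ys \<in> P"
    using Cons.prems additive_subgroup_sum_list[OF P] by auto
  then have "N ((y - x) + (sum_list ys - sum_list xs)) \<le> N (y - x) + N (sum_list ys - sum_list xs)"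
    using Cons.prems by (intro group_norm_props(3)[OF P N] additive_subgroup_closed(2)[OF P]) auto
  moreover have "N (y - x) \<le> f y + f x"
    using f Cons.prems by (auto simp: katetov_def)
  ultimately show ?case
    using Cons by (auto simp: algebra_simps)
qed

text \<open>
  The new norm is the largest one that is at most \<open>N\<close> on \<open>P\<close> and at most \<open>f x\<close> at \<open>g - x\<close>.
  The grading \<open>\<kappa>\<close> forces the words that represent an element of \<open>P\<close> to use as many letters
  \<open>g - x\<close> as letters \<open>- (g - y)\<close>, and each such pair costs \<open>f x + f y \<ge> N (y - x)\<close>.
\<close>

lemma extend_group_norm:
  fixes g :: "'a::ab_group_add" and \<kappa> :: "'a \<Rightarrow> int"
  assumes Q: "additive_subgroup Q" and P: "additive_subgroup P" and PQ: "P = {x\<in>Q. \<kappa> x = 0}"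
    and \<kappa>: "\<And>x y. \<kappa> (x - y) = \<kappa> x - \<kappa> y" and g: "g \<in> Q" "\<kappa> g = 1"
    and N: "group_norm P N" and f: "katetov P N f"
    and \<delta>: "0 < \<delta>" "\<And>x. x \<in> P \<Longrightarrow> \<delta> \<le> f x"
  obtains N' where "group_norm Q N'" "\<And>x. x \<in> P \<Longrightarrow> N' x = N x"
    "\<And>x. x \<in> P \<Longrightarrow> N' (g - x) = f x"
proof -
  define W where "W = word_costs P N f g"
  define N' where "N' z = Inf (W z)" for z
  note clP = additive_subgroup_closed[OF P] and clQ = additive_subgroup_closed[OF Q]
  note nP = group_norm_props[OF P N]
  have N0: "N 0 = 0" using N by (simp add: group_norm_def)
  have \<kappa>0: "\<kappa> 0 = 0" using \<kappa>[of 0 0] by simp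
  have \<kappa>add: "\<kappa> (x + y) = \<kappa> x + \<kappa> y" for x y
    using \<kappa>[of x "0 - y"] \<kappa>[of 0 y] \<kappa>0 by simp
  have \<kappa>P: "\<kappa> x = 0" if "x \<in> P" for x using that PQ by simp
  have \<kappa>sum: "\<kappa> (\<Sum>x\<leftarrow>xs. g - x) = int (length xs)" if "set xs \<subseteq> P" for xs
    using that by (induction xs) (auto simp: \<kappa>0 \<kappa>add \<kappa> \<kappa>P g)
  have sum_g: "(\<Sum>x\<leftarrow>xs. g - x) - (\<Sum>x\<leftarrow>ys. g - x) = sum_list ys - sum_list xs"
    if "length xs = length ys" for xs ys
    using that by (induction rule: list_induct2) (auto simp: algebra_simps)
  have WI: "N y + (\<Sum>x\<leftarrow>xs. f x) + (\<Sum>x\<leftarrow>ys. f x) \<in> W z"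
    if "y \<in> P" "set xs \<subseteq> P" "set ys \<subseteq> P" "z = y + (\<Sum>x\<leftarrow>xs. g - x) - (\<Sum>x\<leftarrow>ys. g - x)"
    for y xs ys z
    using that unfolding W_def word_costs_def by blast
  have WE: R if cW: "c \<in> W z"
    and R: "\<And>y xs ys. \<lbrakk>y \<in> P; set xs \<subseteq> P; set ys \<subseteq> P; z = y + (\<Sum>x\<leftarrow>xs. g - x) - (\<Sum>x\<leftarrow>ys. g - x);
      c = N y + (\<Sum>x\<leftarrow>xs. f x) + (\<Sum>x\<leftarrow>ys. f x); \<kappa> z = int (length xs) - int (length ys)\<rbrakk> \<Longrightarrow> R"
    for c z R
  proof -
    obtain y xs ys where w: "y \<in> P" "set xs \<subseteq> P" "set ys \<subseteq> P"
      "z = y + (\<Sum>x\<leftarrow>xs. g - x) - (\<Sum>x\<leftarrow>ys. g - x)" "c = N y + (\<Sum>x\<leftarrow>xs. f x) + (\<Sum>x\<leftarrow>ys. f x)"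
      using cW unfolding W_def word_costs_def by blast
    then have "\<kappa> z = int (length xs) - int (length ys)"
      by (simp add: \<kappa> \<kappa>add \<kappa>sum \<kappa>P)
    with w show R using R by blast
  qed
  have sum_f: "0 \<le> (\<Sum>x\<leftarrow>xs. f x)" "xs \<noteq> [] \<Longrightarrow> \<delta> \<le> (\<Sum>x\<leftarrow>xs. f x)" if "set xs \<subseteq> P" for xs
  proof -
    have *: "0 \<le> (\<Sum>x\<leftarrow>xs. f x)" if "set xs \<subseteq> P" for xs
      using that \<delta> by (intro sum_list_nonneg) force
    then show "0 \<le> (\<Sum>x\<leftarrow>xs. f x)" using that .
    show "\<delta> \<le> (\<Sum>x\<leftarrow>xs. f x)" if "xs \<noteq> []"
    proof (cases xs)
      case (Cons x ys)
      then show ?thesis using \<open>set xs \<subseteq> P\<close> *[of ys] \<delta>(2)[of x] by auto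
    qed (use that in simp)
  qed
  have W_nonneg: "0 \<le> c" if "c \<in> W z" for c z
    using that by (rule WE) (auto intro!: add_nonneg_nonneg nP(2) sum_f)
  then have bdd: "bdd_below (W z)" for z by (auto intro: bdd_belowI[of _ 0])
  have nonempty: "W z \<noteq> {}" if z: "z \<in> Q" for z
  proof -
    \<comment> \<open>Removing \<open>\<kappa> z\<close> letters \<open>g - 0\<close>, or adding
      them if \<open>\<kappa> z\<close> is negative, leaves an element of grade 0, hence of
      \<open>P\<close>. \<open>nat\<close> empties the list of the other sign.\<close>
    define xs ys where "xs = replicate (nat (\<kappa> z)) (0::'a)" and "ys = replicate (nat (- \<kappa> z)) (0::'a)"
    have sub: "set xs \<subseteq> P" "set ys \<subseteq> P"
      using clP(1) by (auto simp: xs_def ys_def)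
    have Qsum: "(\<Sum>x\<leftarrow>as. g - x) \<in> Q" if "set as \<subseteq> P" for as
      using that PQ by (intro additive_subgroup_sum_list[OF Q]) (auto intro!: clQ g)
    define y where "y = z - (\<Sum>x\<leftarrow>xs. g - x) + (\<Sum>x\<leftarrow>ys. g - x)"
    have "y \<in> Q" unfolding y_def by (intro clQ Qsum sub z)
    moreover have "\<kappa> y = 0"
      unfolding y_def \<kappa>add \<kappa> \<kappa>sum[OF sub(1)] \<kappa>sum[OF sub(2)] by (simp add: xs_def ys_def)
    ultimately have "y \<in> P" using PQ by simp
    from WI[OF this sub, of z] show ?thesis by (auto simp: y_def)
  qed
  have lower: "N' z \<le> c" if "c \<in> W z" for c z
    unfolding N'_def using that bdd by (rule cInf_lower)
  have greatest: "c \<le> N' z" if "z \<in> Q" "\<And>c'. c' \<in> W z \<Longrightarrow> c \<le> c'" for c z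
    unfolding N'_def using nonempty[OF that(1)] that(2) by (rule cInf_greatest)
  have N'P: "N' z = N z" if z: "z \<in> P" for z
  proof (rule antisym)
    show "N' z \<le> N z"
    proof (rule lower)
      show "N z \<in> W z" using WI[OF z, of "[]" "[]" z] by simp
    qed
    show "N z \<le> N' z"
    proof (rule greatest)
      show "z \<in> Q" using z PQ by simp
      fix c assume "c \<in> W z"
      then show "N z \<le> c"
      proof (rule WE)
        fix y xs ys assume y: "y \<in> P" and sub: "set xs \<subseteq> P" "set ys \<subseteq> P"
          and zeq: "z = y + (\<Sum>x\<leftarrow>xs. g - x) - (\<Sum>x\<leftarrow>ys. g - x)"
          and c: "c = N y + (\<Sum>x\<leftarrow>xs. f x) + (\<Sum>x\<leftarrow>ys. f x)"
          and "\<kappa> z = int (length xs) - int (length ys)"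
        then have len: "length xs = length ys" using \<kappa>P[OF z] by simp
        have "z = y + (sum_list ys - sum_list xs)"
          unfolding sum_g[OF len, symmetric] using zeq by (simp add: algebra_simps)
        moreover have "sum_list ys - sum_list xs \<in> P"
          using sub by (intro clP additive_subgroup_sum_list[OF P])
        ultimately show "N z \<le> c"
          using nP(3)[OF y, of "sum_list ys - sum_list xs"] katetov_balanced[OF P N f len sub] c
          by simp
      qed
    qed
  qed
  have N'g: "N' (g - b) = f b" if b: "b \<in> P" for b
  proof (rule antisym)
    show "N' (g - b) \<le> f b"
    proof (rule lower)
      show "f b \<in> W (g - b)" using WI[OF clP(1), of "[b]" "[]" "g - b"] b N0 by simp
    qed
    show "f b \<le> N' (g - b)"
    proof (rule greatest)
      show "g - b \<in> Q" using b PQ g clQ by simp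
      fix c assume "c \<in> W (g - b)"
      then show "f b \<le> c"
      proof (rule WE)
        fix y xs ys assume y: "y \<in> P" and sub: "set xs \<subseteq> P" "set ys \<subseteq> P"
          and zeq: "g - b = y + (\<Sum>x\<leftarrow>xs. g - x) - (\<Sum>x\<leftarrow>ys. g - x)"
          and c: "c = N y + (\<Sum>x\<leftarrow>xs. f x) + (\<Sum>x\<leftarrow>ys. f x)"
          and grade: "\<kappa> (g - b) = int (length xs) - int (length ys)"
        \<comment> \<open>In grade 1 there is one surplus positive letter \<open>g - x\<close>.
          Without it the letters balance and sum to some \<open>s\<close> in \<open>P\<close>, so
          \<open>x - b = y + s\<close>; the Lipschitz half of \<open>katetov\<close> then compares
          \<open>f b\<close> with \<open>f x\<close>.\<close>
        have "\<kappa> (g - b) = 1" using \<kappa>P[OF b] by (simp add: \<kappa> g)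
        then have "length xs = Suc (length ys)" using grade by simp
        then obtain x xs' where xs: "xs = x # xs'" and len: "length xs' = length ys"
          by (cases xs) auto
        define s where "s = sum_list ys - sum_list xs'"
        have s: "s \<in> P" unfolding s_def
          using sub xs by (intro clP additive_subgroup_sum_list[OF P]) auto
        have x: "x \<in> P" using sub xs by simp
        have "g - b = y + (g - x) + s"
          unfolding s_def sum_g[OF len, symmetric] using zeq by (simp add: xs algebra_simps)
        then have "(g - b) - (g - x) = y + s" by (simp add: algebra_simps)
        then have eq: "x - b = y + s" by simp
        have "f b \<le> f x + N (b - x)" using f b x by (simp add: katetov_def)
        also have "N (b - x) = N (y + s)" using nP(4)[OF b x] eq by simp
        also have "N (y + s) \<le> N y + N s" using nP(3) y s .
        also have "N s \<le> (\<Sum>x\<leftarrow>xs'. f x) + (\<Sum>x\<leftarrow>ys. f x)"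
          unfolding s_def using katetov_balanced[OF P N f len] sub xs by simp
        finally show "f b \<le> c" using c xs by simp
      qed
    qed
  qed
  have "group_norm Q N'"
    unfolding group_norm_def
  proof (intro conjI ballI impI)
    show "N' 0 = 0" using N'P[OF clP(1)] N0 by simp
    fix z assume z: "z \<in> Q"
    show "0 < N' z" if "z \<noteq> 0"
    proof -
      \<comment> \<open>A word without letters represents \<open>z\<close> only if \<open>z\<close>
        lies in \<open>P\<close>, at cost \<open>N z\<close>; every other word costs at least
        \<open>\<delta>\<close>. This keeps the infimum away from 0.\<close>
      define m where "m = (if z \<in> P then min (N z) \<delta> else \<delta>)"
      have "m \<le> N' z" using z
      proof (rule greatest)
        fix c assume "c \<in> W z"
        then show "m \<le> c"
        proof (rule WE)
          fix y xs ys assume y: "y \<in> P" and sub: "set xs \<subseteq> P" "set ys \<subseteq> P"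
            and zeq: "z = y + (\<Sum>x\<leftarrow>xs. g - x) - (\<Sum>x\<leftarrow>ys. g - x)"
            and c: "c = N y + (\<Sum>x\<leftarrow>xs. f x) + (\<Sum>x\<leftarrow>ys. f x)"
          show "m \<le> c"
          proof (cases "xs = [] \<and> ys = []")
            case True
            then show ?thesis using zeq c y by (simp add: m_def)
          next
            case False
            then have "\<delta> \<le> c"
              using c sum_f[OF sub(1)] sum_f[OF sub(2)] nP(2)[OF y] by auto
            then show ?thesis by (auto simp: m_def)
          qed
        qed
      qed
      moreover have "0 < m" using N that \<delta> by (auto simp: m_def group_norm_def)
      ultimately show ?thesis by simp
    qed
    fix z' assume z': "z' \<in> Q"
    have step: "N' (z - z') \<le> c + c'" if "c \<in> W z" "c' \<in> W z'" for c c'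
      using that(1)
    proof (rule WE)
      fix y xs ys assume w: "y \<in> P" "set xs \<subseteq> P" "set ys \<subseteq> P"
        "z = y + (\<Sum>x\<leftarrow>xs. g - x) - (\<Sum>x\<leftarrow>ys. g - x)"
        "c = N y + (\<Sum>x\<leftarrow>xs. f x) + (\<Sum>x\<leftarrow>ys. f x)"
      show ?thesis using that(2)
      proof (rule WE)
        fix y' xs' ys' assume w': "y' \<in> P" "set xs' \<subseteq> P" "set ys' \<subseteq> P"
          "z' = y' + (\<Sum>x\<leftarrow>xs'. g - x) - (\<Sum>x\<leftarrow>ys'. g - x)"
          "c' = N y' + (\<Sum>x\<leftarrow>xs'. f x) + (\<Sum>x\<leftarrow>ys'. f x)"
        \<comment> \<open>Negating a word exchanges its two lists of letters at the same
          cost.\<close>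
        have "z - z' = (y - y') + (\<Sum>x\<leftarrow>xs @ ys'. g - x) - (\<Sum>x\<leftarrow>ys @ xs'. g - x)"
          unfolding w(4) w'(4) by (simp add: algebra_simps)
        then have "N' (z - z') \<le> N (y - y') + (\<Sum>x\<leftarrow>xs @ ys'. f x) + (\<Sum>x\<leftarrow>ys @ xs'. f x)"
          using w(1-3) w'(1-3) by (intro lower WI clP) auto
        moreover have "N (y - y') \<le> N y + N y'"
          using N w(1) w'(1) by (simp add: group_norm_def)
        ultimately show ?thesis using w(5) w'(5) by simp
      qed
    qed
    \<comment> \<open>The infimum is taken over the words for \<open>z\<close> with
      \<open>c'\<close> fixed, and then over the words for \<open>z'\<close>.\<close>
    have "N' (z - z') - c' \<le> N' z" if "c' \<in> W z'" for c'
      using z by (rule greatest) (use step that in \<open>simp add: algebra_simps\<close>)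
    then have "N' (z - z') - N' z \<le> N' z'"
      by (intro greatest[OF z']) (simp add: algebra_simps)
    then show "N' (z - z') \<le> N' z + N' z'" by simp
  qed
  then show thesis using that N'P N'g by blast
qed

lemma extend_katetov:
  assumes P: "additive_subgroup P" and N: "group_norm P N"
    and F: "finite F" "F \<noteq> {}" "F \<subseteq> P" and f: "katetov F N f" and pos: "\<And>x. x \<in> F \<Longrightarrow> 0 < f x"
  obtains h \<delta> where "katetov P N h" "0 < \<delta>" "\<And>x. x \<in> P \<Longrightarrow> \<delta> \<le> h x" "\<And>x. x \<in> F \<Longrightarrow> h x = f x"
proof -
  note nP = group_norm_props[OF P N]
  define h where "h x = Min ((\<lambda>a. f a + N (a - x)) ` F)" for x
  have le: "h x \<le> f a + N (a - x)" if "a \<in> F" for a x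
    unfolding h_def using F that by (intro Min_le) auto
  have ex: "\<exists>a\<in>F. h x = f a + N (a - x)" for x
  proof -
    have "h x \<in> (\<lambda>a. f a + N (a - x)) ` F"
      unfolding h_def using F by (intro Min_in) auto
    then show ?thesis by blast
  qed
  have "katetov P N h"
    unfolding katetov_def
  proof (intro ballI conjI)
    fix x y assume x: "x \<in> P" and y: "y \<in> P"
    obtain a b where a: "a \<in> F" "h x = f a + N (a - x)" and b: "b \<in> F" "h y = f b + N (b - y)"
      using ex by meson
    have aP: "a \<in> P" and bP: "b \<in> P" using a b F by auto
    have "h x \<le> f b + N (b - x)" using le b by blast
    also have "N (b - x) \<le> N (b - y) + N (y - x)" using nP(5) bP x y by blast
    finally show "h x \<le> h y + N (x - y)" using b nP(4)[OF x y] by simp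
    have "N (x - y) \<le> N (x - a) + N (a - y)" using nP(5) x aP y by blast
    also have "N (a - y) \<le> N (a - b) + N (b - y)" using nP(5) aP bP y by blast
    also have "N (a - b) \<le> f a + f b" using f a b by (simp add: katetov_def)
    finally show "N (x - y) \<le> h x + h y" using a b nP(4)[OF x aP] by simp
  qed
  moreover have "0 < Min (f ` F)" using F pos by simp
  moreover have "Min (f ` F) \<le> h x" if x: "x \<in> P" for x
  proof -
    obtain a where a: "a \<in> F" "h x = f a + N (a - x)" using ex by blast
    moreover have "0 \<le> N (a - x)"
      using a F x by (intro nP(2) additive_subgroup_closed(2)[OF P]) auto
    moreover have "Min (f ` F) \<le> f a" using F a by simp
    ultimately show ?thesis by simp
  qed
  moreover have "h x = f x" if x: "x \<in> F" for x
  proof (rule antisym)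
    show "h x \<le> f x" using le[OF x, of x] N by (simp add: group_norm_def)
    obtain a where a: "a \<in> F" "h x = f a + N (a - x)" using ex by blast
    moreover have "a \<in> P" "x \<in> P" using a x F by auto
    ultimately show "f x \<le> h x" using f x nP(4)[of a x] by (simp add: katetov_def)
  qed
  ultimately show thesis using that by blast
qed

section \<open>Translations of a completed group\<close>

text \<open>Such a \<open>U\<close> is the Hausdorff completion of \<open>'b\<close> for the
  pseudometric pulled back along \<open>\<phi>\<close>. The group operations are carried to
  \<open>U\<close> itself by limits of image points.\<close>

locale dense_invariant_map =
  fixes U :: "'a metric" and \<phi> :: "'b::ab_group_add \<Rightarrow> 'a"
  assumes complete: "mcomplete_of U"
    and range: "\<phi> x \<in> mspace U"
    and invariant: "mdist U (\<phi> (x + z)) (\<phi> (y + z)) = mdist U (\<phi> x) (\<phi> y)"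
    and dense: "\<lbrakk>u \<in> mspace U; 0 < e\<rbrakk> \<Longrightarrow> \<exists>x. mdist U (\<phi> x) u < e"
begin

abbreviation M :: "'a set" where "M \<equiv> mspace U"

sublocale Metric_space M "mdist U"
  by simp

text \<open>The way through \<open>\<phi> (a' + b)\<close> changes one summand at a time, and
  invariance cancels the other. This uniform continuity lets addition pass to limits.\<close>

lemma dist_add:
  "mdist U (\<phi> (a + b)) (\<phi> (a' + b')) \<le> mdist U (\<phi> a) (\<phi> a') + mdist U (\<phi> b) (\<phi> b')"
proof -
  have "mdist U (\<phi> (a + b)) (\<phi> (a' + b'))
      \<le> mdist U (\<phi> (a + b)) (\<phi> (a' + b)) + mdist U (\<phi> (b + a')) (\<phi> (b' + a'))"
    using triangle[of "\<phi> (a + b)" "\<phi> (a' + b)" "\<phi> (a' + b')"] range by (simp add: add.commute)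
  then show ?thesis by (simp add: invariant)
qed

text \<open>Adding \<open>a + b\<close> turns the pair \<open>- a\<close>, \<open>- b\<close> into
  \<open>b\<close>, \<open>a\<close>.\<close>

lemma dist_uminus: "mdist U (\<phi> (- a)) (\<phi> (- b)) = mdist U (\<phi> a) (\<phi> b)"
  using invariant[of "- a" "a + b" "- b"] by (simp add: commute add.commute)

lemma approximating_sequence:
  assumes "u \<in> M"
  obtains s where "\<And>n. mdist U u (\<phi> (s n)) < inverse (Suc n)"
proof -
  have "\<exists>x. mdist U u (\<phi> x) < inverse (Suc n)" for n :: nat
    using dense[OF assms, of "inverse (Suc n)"] by (simp add: commute)
  then show thesis using that by metis
qed

lemma eq_if_close:
  assumes "u \<in> M" "v \<in> M" and "\<And>e. 0 < e \<Longrightarrow> mdist U u v \<le> e"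
  shows "u = v"
  using assms field_le_epsilon[of "mdist U u v" 0] by (simp add: order_antisym_conv)

text \<open>The limit \<open>w\<close> is described only by the distance bounds that it inherits, so
  that its users work with inequalities instead of sequences. \<open>C\<close> is 2 for sums, which
  have two approximating sequences, and 1 for negatives.\<close>

lemma limit_exists:
  fixes s :: "nat \<Rightarrow> 'b" and C :: real
  assumes cauchy: "\<And>m n. mdist U (\<phi> (s m)) (\<phi> (s n)) \<le> C * (inverse (Suc m) + inverse (Suc n))"
  shows "\<exists>w\<in>M. \<forall>p\<in>M. \<forall>r.
    (\<forall>n. mdist U (\<phi> (s n)) p \<le> r + C * inverse (Suc n)) \<longrightarrow> mdist U w p \<le> r"
proof -
  have small: "\<exists>K. \<forall>n\<ge>K. C * inverse (Suc n) < e" if "0 < e" for e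
  proof -
    have "(\<lambda>n. C * inverse (real (Suc n))) \<longlonglongrightarrow> C * 0"
      by (intro tendsto_mult_left LIMSEQ_inverse_real_of_nat)
    then have "\<forall>\<^sub>F n in sequentially. C * inverse (real (Suc n)) < e"
      using order_tendstoD(2)[of _ "C * 0" sequentially e] that by simp
    then show ?thesis by (simp add: eventually_sequentially)
  qed
  have "MCauchy (\<lambda>n. \<phi> (s n))"
    unfolding MCauchy_def
  proof (intro conjI allI impI)
    show "range (\<lambda>n. \<phi> (s n)) \<subseteq> M" using range by auto
    fix e :: real assume "0 < e"
    then obtain K where K: "\<And>n. n \<ge> K \<Longrightarrow> C * inverse (Suc n) < e / 2"
      using small[of "e / 2"] by auto
    have "mdist U (\<phi> (s m)) (\<phi> (s n)) < e" if "K \<le> m" "K \<le> n" for m n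
      using cauchy[of m n] K[OF that(1)] K[OF that(2)] by (simp add: distrib_left)
    then show "\<exists>K. \<forall>m n. K \<le> m \<longrightarrow> K \<le> n \<longrightarrow> mdist U (\<phi> (s m)) (\<phi> (s n)) < e" by blast
  qed
  then obtain w where "limitin mtopology (\<lambda>n. \<phi> (s n)) w sequentially"
    using complete by (auto simp: mcomplete_of_def mcomplete_def)
  then have w: "w \<in> M" and lim: "\<And>e. 0 < e \<Longrightarrow> \<exists>K. \<forall>n\<ge>K. mdist U (\<phi> (s n)) w < e"
    unfolding limit_metric_sequentially by blast+
  have "mdist U w p \<le> r"
    if p: "p \<in> M" and le: "\<And>n. mdist U (\<phi> (s n)) p \<le> r + C * inverse (Suc n)" for p r
  proof (rule field_le_epsilon)
    fix e :: real assume e: "0 < e"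
    obtain K where K: "\<And>n. n \<ge> K \<Longrightarrow> C * inverse (Suc n) < e / 2"
      using small[of "e / 2"] e by auto
    obtain L where L: "\<And>n. n \<ge> L \<Longrightarrow> mdist U (\<phi> (s n)) w < e / 2"
      using lim[of "e / 2"] e by auto
    define n where "n = max K L"
    have "mdist U w p \<le> mdist U (\<phi> (s n)) w + mdist U (\<phi> (s n)) p"
      using triangle''[of w "\<phi> (s n)" p] w p range by blast
    then show "mdist U w p \<le> r + e"
      using le[of n] K[of n] L[of n] by (simp add: n_def)
  qed
  with w show ?thesis by blast
qed

section \<open>Addition and negation on the whole space\<close>

lemma add_exists:
  assumes u: "u \<in> M" and v: "v \<in> M"
  shows "\<exists>w\<in>M. \<forall>a b. mdist U w (\<phi> (a + b)) \<le> mdist U u (\<phi> a) + mdist U v (\<phi> b)"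
proof -
  obtain s where s: "\<And>n. mdist U u (\<phi> (s n)) < inverse (Suc n)" using approximating_sequence[OF u] by blast
  obtain t where t: "\<And>n. mdist U v (\<phi> (t n)) < inverse (Suc n)" using approximating_sequence[OF v] by blast
  have near: "mdist U (\<phi> (s n + t n)) (\<phi> (a + b))
      \<le> mdist U u (\<phi> a) + mdist U v (\<phi> b) + 2 * inverse (Suc n)" for n a b
    using dist_add[of "s n" "t n" a b] triangle''[of "\<phi> (s n)" u "\<phi> a"]
      triangle''[of "\<phi> (t n)" v "\<phi> b"] s[of n] t[of n] u v range by simp
  \<comment> \<open>Taking \<open>s n\<close> and \<open>t n\<close> for \<open>a\<close> and
    \<open>b\<close> in \<open>near\<close> gives the Cauchy estimate.\<close>
  have "mdist U (\<phi> (s m + t m)) (\<phi> (s n + t n)) \<le> 2 * (inverse (Suc m) + inverse (Suc n))" for m n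
  using near[of m "s n" "t n"] s[of n] t[of n] by simp
  then obtain w where w: "w \<in> M" and
    lim: "\<forall>p\<in>M. \<forall>r. (\<forall>n. mdist U (\<phi> (s n + t n)) p \<le> r + 2 * inverse (Suc n)) \<longrightarrow> mdist U w p \<le> r"
    using limit_exists[of "\<lambda>n. s n + t n" 2] by blast
  show ?thesis
    using w
  proof (rule bexI[rotated], intro allI)
    show "mdist U w (\<phi> (a + b)) \<le> mdist U u (\<phi> a) + mdist U v (\<phi> b)" for a b
      using lim near range by simp
  qed
qed

lemma minus_exists:
  assumes u: "u \<in> M"
  shows "\<exists>w\<in>M. \<forall>a. mdist U w (\<phi> (- a)) \<le> mdist U u (\<phi> a)"
proof -
  obtain s where s: "\<And>n. mdist U u (\<phi> (s n)) < inverse (Suc n)" using approximating_sequence[OF u] by blast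
  have near: "mdist U (\<phi> (- s n)) (\<phi> (- a)) \<le> mdist U u (\<phi> a) + 1 * inverse (Suc n)" for n a
    using triangle''[of "\<phi> (s n)" u "\<phi> a"] s[of n] u range by (simp add: dist_uminus)
  have "mdist U (\<phi> (- s m)) (\<phi> (- s n)) \<le> 1 * (inverse (Suc m) + inverse (Suc n))" for m n
  using near[of m "s n"] s[of n] by simp
  then obtain w where w: "w \<in> M" and
    lim: "\<forall>p\<in>M. \<forall>r. (\<forall>n. mdist U (\<phi> (- s n)) p \<le> r + 1 * inverse (Suc n)) \<longrightarrow> mdist U w p \<le> r"
    using limit_exists[of "\<lambda>n. - s n" 1] by blast
  show ?thesis
    using w
  proof (rule bexI[rotated], intro allI)
    show "mdist U w (\<phi> (- a)) \<le> mdist U u (\<phi> a)" for a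
      using lim near range by simp
  qed
qed

text \<open>For \<open>u\<close> and \<open>v\<close> in \<open>M\<close> the inequality determines
  \<open>w\<close>: any two candidates are close to \<open>\<phi> (a + b)\<close>, and the bound
  tends to 0 as \<open>\<phi> a\<close> and \<open>\<phi> b\<close> approach \<open>u\<close> and
  \<open>v\<close>.\<close>

definition add :: "'a \<Rightarrow> 'a \<Rightarrow> 'a" (infixl "\<boxplus>" 65) where
  "u \<boxplus> v = (SOME w. w \<in> M \<and> (\<forall>a b. mdist U w (\<phi> (a + b)) \<le> mdist U u (\<phi> a) + mdist U v (\<phi> b)))"

definition minus :: "'a \<Rightarrow> 'a" where
  "minus u = (SOME w. w \<in> M \<and> (\<forall>a. mdist U w (\<phi> (- a)) \<le> mdist U u (\<phi> a)))"

lemma add: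
  assumes "u \<in> M" "v \<in> M"
  shows "u \<boxplus> v \<in> M" and "mdist U (u \<boxplus> v) (\<phi> (a + b)) \<le> mdist U u (\<phi> a) + mdist U v (\<phi> b)"
proof -
  have "u \<boxplus> v \<in> M \<and> (\<forall>a b. mdist U (u \<boxplus> v) (\<phi> (a + b)) \<le> mdist U u (\<phi> a) + mdist U v (\<phi> b))"
    unfolding add_def by (rule someI_ex) (use add_exists[OF assms] in blast)
  then show "u \<boxplus> v \<in> M" "mdist U (u \<boxplus> v) (\<phi> (a + b)) \<le> mdist U u (\<phi> a) + mdist U v (\<phi> b)"
    by blast+
qed

lemma minus:
  assumes "u \<in> M"
  shows "minus u \<in> M" and "mdist U (minus u) (\<phi> (- a)) \<le> mdist U u (\<phi> a)"
proof -
  have "minus u \<in> M \<and> (\<forall>a. mdist U (minus u) (\<phi> (- a)) \<le> mdist U u (\<phi> a))"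
    unfolding minus_def by (rule someI_ex) (use minus_exists[OF assms] in blast)
  then show "minus u \<in> M" "mdist U (minus u) (\<phi> (- a)) \<le> mdist U u (\<phi> a)"
    by blast+
qed

lemma close_image_point:
  assumes "u \<in> M" "0 < e"
  obtains a where "mdist U u (\<phi> a) < e"
  using dense[OF assms] by (auto simp: commute)

text \<open>With \<open>a\<close> and \<open>b\<close> as their own approximations the bound in
  \<open>add\<close> is 0.\<close>

lemma add_\<phi>: "\<phi> a \<boxplus> \<phi> b = \<phi> (a + b)"
  using add(1)[OF range range, of a b] add(2)[OF range range, of a b a b] range[of "a + b"] range[of a] range[of b]
    nonneg[of "\<phi> a \<boxplus> \<phi> b" "\<phi> (a + b)"] by (simp add: order_antisym_conv)

text \<open>When \<open>\<phi> a\<close> and \<open>\<phi> b\<close> are near the arguments, both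
  sides are near the image of the same element of \<open>'b\<close>. Each approximation error enters
  once per side, hence \<open>e / 4\<close>, and \<open>e / 6\<close> for three arguments. The other
  group laws hold for the same reason.\<close>

lemma add_commute:
  assumes u: "u \<in> M" and v: "v \<in> M"
  shows "u \<boxplus> v = v \<boxplus> u"
proof (rule eq_if_close)
  fix e :: real assume "0 < e"
  then have e: "0 < e / 4" by simp
  obtain a where a: "mdist U u (\<phi> a) < e / 4" using close_image_point[OF u e] .
  obtain b where b: "mdist U v (\<phi> b) < e / 4" using close_image_point[OF v e] .
  show "mdist U (u \<boxplus> v) (v \<boxplus> u) \<le> e"
    using triangle'[of "u \<boxplus> v" "\<phi> (a + b)" "v \<boxplus> u"] add(1)[OF u v] add(1)[OF v u] range[of "a + b"]
      add(2)[OF u v, of a b] add(2)[OF v u, of b a] a b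
    by (simp add: add.commute)
qed (use add u v in auto)

lemma add_assoc:
  assumes u: "u \<in> M" and v: "v \<in> M" and w: "w \<in> M"
  shows "(u \<boxplus> v) \<boxplus> w = u \<boxplus> (v \<boxplus> w)"
proof (rule eq_if_close)
  note uv = add[OF u v] and vw = add[OF v w]
  show m: "(u \<boxplus> v) \<boxplus> w \<in> M" "u \<boxplus> (v \<boxplus> w) \<in> M"
    using add(1) uv vw u w by auto
  fix e :: real assume "0 < e"
  then have e: "0 < e / 6" by simp
  obtain a where a: "mdist U u (\<phi> a) < e / 6" using close_image_point[OF u e] .
  obtain b where b: "mdist U v (\<phi> b) < e / 6" using close_image_point[OF v e] .
  obtain c where c: "mdist U w (\<phi> c) < e / 6" using close_image_point[OF w e] .
  show "mdist U ((u \<boxplus> v) \<boxplus> w) (u \<boxplus> (v \<boxplus> w)) \<le> e"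
    using triangle'[OF m(1) range[of "a + b + c"] m(2)]
      add(2)[OF uv(1) w, of "a + b" c] add(2)[OF u vw(1), of a "b + c"]
      uv(2)[of a b] vw(2)[of b c] a b c
    by (simp add: add.assoc)
qed

lemma add_zero:
  assumes u: "u \<in> M"
  shows "u \<boxplus> \<phi> 0 = u"
proof (rule eq_if_close)
  fix e :: real assume "0 < e"
  then have e: "0 < e / 2" by simp
  obtain a where a: "mdist U u (\<phi> a) < e / 2" using close_image_point[OF u e] .
  show "mdist U (u \<boxplus> \<phi> 0) u \<le> e"
    using triangle'[OF add(1)[OF u range] range[of a] u, of 0] add(2)[OF u range, of 0 a 0] a range[of 0]
    by simp
qed (use add u range in auto)

lemma add_minus:
  assumes u: "u \<in> M"
  shows "u \<boxplus> minus u = \<phi> 0"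
proof (rule eq_if_close)
  fix e :: real assume "0 < e"
  then have e: "0 < e / 2" by simp
  obtain a where a: "mdist U u (\<phi> a) < e / 2" using close_image_point[OF u e] .
  show "mdist U (u \<boxplus> minus u) (\<phi> 0) \<le> e"
    using add(2)[OF u minus(1)[OF u], of a "- a"] minus(2)[OF u, of a] a by simp
qed (use add minus u range in auto)

lemma dist_translate:
  assumes u: "u \<in> M" and v: "v \<in> M" and w: "w \<in> M"
  shows "mdist U (u \<boxplus> w) (v \<boxplus> w) = mdist U u v"
proof -
  have le: "\<bar>mdist U (u \<boxplus> w) (v \<boxplus> w) - mdist U u v\<bar> \<le> 0"
  proof (rule field_le_epsilon)
    fix e :: real assume "0 < e"
    then have e: "0 < e / 6" by simp
    obtain a where a: "mdist U u (\<phi> a) < e / 6" using close_image_point[OF u e] .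
    obtain b where b: "mdist U v (\<phi> b) < e / 6" using close_image_point[OF v e] .
    obtain c where c: "mdist U w (\<phi> c) < e / 6" using close_image_point[OF w e] .
    note uw = add[OF u w] and vw = add[OF v w]
    \<comment> \<open>Passing from \<open>u \<boxplus> w\<close> and \<open>v \<boxplus> w\<close>
      to image points costs four errors, and from \<open>u\<close> and \<open>v\<close> two more.
      For the image points the two distances agree by \<open>invariant\<close>.\<close>
    have near: "\<bar>mdist U x y - mdist U x' y'\<bar> \<le> mdist U x x' + mdist U y y'"
      if "x \<in> M" "y \<in> M" "x' \<in> M" "y' \<in> M" for x y x' y'
      using that triangle[of x x' y] triangle[of x' y' y] triangle[of x' x y'] triangle[of x y y']
        commute[of x x'] commute[of y y'] by simp
    show "\<bar>mdist U (u \<boxplus> w) (v \<boxplus> w) - mdist U u v\<bar> \<le> 0 + e"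
      using near[OF uw(1) vw(1) range[of "a + c"] range[of "b + c"]]
        near[OF u v range[of a] range[of b]] invariant[of a c b]
        uw(2)[of a c] vw(2)[of b c] a b c by simp
  qed
  then show ?thesis by simp
qed

section \<open>The group of translations\<close>

definition translation :: "'a \<Rightarrow> 'a \<Rightarrow> 'a" where
  "translation w = (\<lambda>u\<in>M. u \<boxplus> w)"

abbreviation translation_group :: "('a \<Rightarrow> 'a) monoid" where
  "translation_group \<equiv> isometry_group U \<lparr>carrier := translation ` M\<rparr>"

lemma minus_cancel:
  assumes "u \<in> M" "w \<in> M"
  shows "u \<boxplus> minus w \<boxplus> w = u"
  using assms by (metis add_assoc add_commute add_minus add_zero minus(1))

lemma isometry_translation:
  assumes w: "w \<in> M"
  shows "isometry U U (translation w)"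
  unfolding isometry_def
proof (intro conjI ballI)
  show "bij_betw (translation w) M M"
  proof (rule bij_betwI[where g = "\<lambda>u. u \<boxplus> minus w"])
    show "translation w \<in> M \<rightarrow> M" and "(\<lambda>u. u \<boxplus> minus w) \<in> M \<rightarrow> M"
      using w by (auto simp: translation_def add minus)
    show "translation w u \<boxplus> minus w = u" if "u \<in> M" for u
      using that w by (simp add: translation_def add_assoc add_minus add_zero minus)
    show "translation w (u \<boxplus> minus w) = u" if "u \<in> M" for u
      using that w by (simp add: translation_def minus_cancel add minus)
  qed
  show "mdist U (translation w x) (translation w y) = mdist U x y" if "x \<in> M" "y \<in> M" for x y
    using that w by (simp add: translation_def dist_translate)
qed

lemma translation_in_carrier: "w \<in> M \<Longrightarrow> translation w \<in> carrier (isometry_group U)"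
  using isometry_translation[of w]
  by (simp add: isometry_group_def) (simp add: translation_def)

lemma mult_translation:
  assumes "v \<in> M" "w \<in> M"
  shows "translation v \<otimes>\<^bsub>isometry_group U\<^esub> translation w = translation (v \<boxplus> w)"
proof -
  have "translation v \<in> Bij M" "translation w \<in> Bij M"
    using isometry_translation assms by (auto simp: Bij_def isometry_def translation_def)
  then show ?thesis
    using assms
    by (auto simp: isometry_group_def BijGroup_def compose_def translation_def add add_assoc
        add_commute[of w v] intro!: restrict_ext)
qed

lemma one_translation: "\<one>\<^bsub>isometry_group U\<^esub> = translation (\<phi> 0)"
  by (auto simp: isometry_group_def BijGroup_def translation_def add_zero)

lemma subgroup_translations: "subgroup (translation ` M) (isometry_group U)"
proof (rule group.subgroupI[OF group_isometry_group])
  show "translation ` M \<subseteq> carrier (isometry_group U)"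
    using translation_in_carrier by blast
  show "translation ` M \<noteq> {}" using range by blast
  fix f assume "f \<in> translation ` M"
  then obtain v where v: "v \<in> M" "f = translation v" by blast
  have "translation (minus v) \<otimes>\<^bsub>isometry_group U\<^esub> translation v = \<one>\<^bsub>isometry_group U\<^esub>"
    using v by (simp add: mult_translation minus one_translation add_commute[of "minus v"] add_minus)
  then have "inv\<^bsub>isometry_group U\<^esub> f = translation (minus v)"
    using v minus translation_in_carrier
    by (intro group.inv_equality[OF group_isometry_group]) auto
  then show "inv\<^bsub>isometry_group U\<^esub> f \<in> translation ` M" using minus v by blast
  fix g assume "g \<in> translation ` M"
  then show "f \<otimes>\<^bsub>isometry_group U\<^esub> g \<in> translation ` M"
    using v add by (auto simp: mult_translation)
qed

lemma comm_group_translations: "comm_group translation_group"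
proof (rule group.group_comm_groupI)
  show "group translation_group"
    by (rule group.subgroup_imp_group[OF group_isometry_group subgroup_translations])
  show "x \<otimes>\<^bsub>translation_group\<^esub> y = y \<otimes>\<^bsub>translation_group\<^esub> x"
    if "x \<in> carrier translation_group" "y \<in> carrier translation_group" for x y
    using that by (auto simp: mult_translation add_commute)
qed

lemma transitive_translations: "transitive_action translation_group M (\<lambda>h. h)"
proof (intro transitive_action.intro group_action.intro group_hom.intro group_hom_axioms.intro
    transitive_action_axioms.intro)
  show "group translation_group" using comm_group_translations by (rule comm_group.axioms)
  show "group (BijGroup M)" by (rule group_BijGroup)
  have "translation ` M \<subseteq> Bij M"
    using isometry_translation by (auto simp: Bij_def isometry_def translation_def)
  then show "(\<lambda>h. h) \<in> hom translation_group (BijGroup M)"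
    by (auto simp: hom_def isometry_group_def BijGroup_def)
  fix x y assume x: "x \<in> M" and y: "y \<in> M"
  have "translation (y \<boxplus> minus x) x = y"
    using x y by (simp add: translation_def add_commute[of x] add minus minus_cancel)
  then show "\<exists>h\<in>carrier translation_group. h x = y"
    using x y add minus by force
qed

text \<open>In the abelian group \<open>'b\<close> the n-fold multiple of \<open>a\<close> is
  expressed by iterated addition.\<close>

lemma pow_translation:
  "translation (\<phi> a) [^]\<^bsub>translation_group\<^esub> n = translation (\<phi> (((+) a ^^ n) 0))"
proof (induction n)
  case 0
  then show ?case by (simp add: one_translation)
next
  case (Suc n)
  then show ?case by (simp add: mult_translation range add_\<phi> add.commute)
qed

lemma infinite_exponent_translations:
  assumes "inj \<phi>" and "\<And>n. 0 < n \<Longrightarrow> \<exists>a::'b. ((+) a ^^ n) 0 \<noteq> 0"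
  shows "infinite_exponent translation_group"
  unfolding infinite_exponent_def
proof (rule notI, elim exE conjE)
  fix n :: nat assume "0 < n" and n: "\<forall>g\<in>carrier translation_group. g [^]\<^bsub>translation_group\<^esub> n = \<one>\<^bsub>translation_group\<^esub>"
  then obtain a :: 'b where a: "((+) a ^^ n) 0 \<noteq> 0" using assms(2) by blast
  have "translation (\<phi> (((+) a ^^ n) 0)) = translation (\<phi> 0)"
    using n range[of a] by (simp add: pow_translation[symmetric] one_translation)
  \<comment> \<open>The value at \<open>\<phi> 0\<close> recovers the element by which a translation
    moves.\<close>
  then have "translation (\<phi> (((+) a ^^ n) 0)) (\<phi> 0) = translation (\<phi> 0) (\<phi> 0)" by simp
  then have "\<phi> (((+) a ^^ n) 0) = \<phi> 0" by (simp add: translation_def range add_\<phi>)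
  then show False using a assms(1) by (simp add: inj_eq)
qed

end

section \<open>Embedding a normed group in the Urysohn space\<close>

lemma polish_metric_finite:
  assumes "Metric_space B d" and "finite B"
  shows "polish_metric (metric (B, d))"
proof -
  interpret Metric_space B d by fact
  have "compact_space mtopology"
    using assms(2) by (simp add: compact_space_def finite_imp_compactin)
  then have "mcomplete" by (rule compact_space_imp_mcomplete)
  moreover have "separable_space mtopology"
    unfolding separable_space_def
    using assms(2) closure_of_topspace[of mtopology] by (intro exI[of _ B]) (auto simp: countable_finite)
  ultimately show ?thesis
    by (simp add: polish_metric_def)
qed

text \<open>Universality embeds \<open>B\<close> by some \<open>f\<close>, but possibly with
  \<open>F\<close> in the wrong place. The map from \<open>f x\<close> to \<open>\<phi> x\<close> is
  an isometry between finite subsets, and homogeneity extends it to an isometry \<open>g\<close> of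
  \<open>U\<close>; then \<open>g \<circ> f\<close> agrees with \<open>\<phi>\<close> on
  \<open>F\<close>.\<close>

lemma urysohn_extend_isometry:
  assumes U: "urysohn_space U" and B: "finite B" "Metric_space B d" and F: "F \<subseteq> B"
    and \<phi>: "\<phi> ` F \<subseteq> mspace U" "\<And>x y. \<lbrakk>x \<in> F; y \<in> F\<rbrakk> \<Longrightarrow> mdist U (\<phi> x) (\<phi> y) = d x y"
  obtains \<psi> where "\<psi> ` B \<subseteq> mspace U" "\<And>x y. \<lbrakk>x \<in> B; y \<in> B\<rbrakk> \<Longrightarrow> mdist U (\<psi> x) (\<psi> y) = d x y"
    "\<And>x. x \<in> F \<Longrightarrow> \<psi> x = \<phi> x"
proof -
  interpret B: Metric_space B d by fact
  have "isometrically_embeds (metric (B, d)) U"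
    using U polish_metric_finite[OF B(2,1)] by (intro universal_metric_embeds) (simp_all add: urysohn_space_def)
  then obtain S f where "S \<subseteq> mspace U" "isometry (metric (B, d)) (submetric U S) f"
    by (auto simp: isometrically_embeds_def)
  then have fU: "f x \<in> mspace U" and fd: "mdist U (f x) (f y) = d x y"
    if "x \<in> B" "y \<in> B" for x y
    using that by (auto simp: isometry_def bij_betw_def)
  have finj: "inj_on f B"
    using fd by (intro inj_onI) (metis B.zero fU mdist_zero)
  have inv: "inv_into B f (f x) = x" if "x \<in> B" for x
    using finj that by simp
  define k where "k = \<phi> \<circ> inv_into B f"
  have kf: "k (f x) = \<phi> x" if "x \<in> F" for x
    using that F inv by (auto simp: k_def)
  have "isometry (submetric U (f ` F)) (submetric U (\<phi> ` F)) k"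
    unfolding isometry_def
  proof (intro conjI ballI)
    have dom: "mspace (submetric U (f ` F)) = f ` F" "mspace (submetric U (\<phi> ` F)) = \<phi> ` F"
      using F fU \<phi>(1) by auto
    have "inj_on k (f ` F)"
    proof (rule inj_onI, clarify)
      fix x y assume xy: "x \<in> F" "y \<in> F" "k (f x) = k (f y)"
      then have "\<phi> x = \<phi> y" by (simp add: kf)
      moreover have "\<phi> x \<in> mspace U" using \<phi>(1) xy by auto
      ultimately have "d x y = 0" using \<phi>(2)[OF xy(1,2)] mdist_zero by metis
      then show "f x = f y" using xy F by (metis B.zero subsetD)
    qed
    then show "bij_betw k (mspace (submetric U (f ` F))) (mspace (submetric U (\<phi> ` F)))"
      unfolding dom by (auto simp: bij_betw_def kf image_iff)
    show "mdist (submetric U (\<phi> ` F)) (k x) (k y) = mdist (submetric U (f ` F)) x y"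
      if "x \<in> mspace (submetric U (f ` F))" "y \<in> mspace (submetric U (f ` F))" for x y
      using that F unfolding dom by (auto simp: kf \<phi>(2) fd subset_iff)
  qed
  moreover have "finite (f ` F)" "f ` F \<subseteq> mspace U" "finite (\<phi> ` F)"
    using B F fU \<phi>(1) by (auto intro: finite_subset)
  ultimately obtain g where g: "isometry U U g" "\<And>x. x \<in> f ` F \<Longrightarrow> g x = k x"
    using U \<phi>(1) unfolding urysohn_space_def homogeneous_metric_def by metis
  show thesis
  proof (rule that[of "g \<circ> f"])
    show "(g \<circ> f) ` B \<subseteq> mspace U"
      using g(1) fU by (auto simp: isometry_def bij_betw_def)
    show "mdist U ((g \<circ> f) x) ((g \<circ> f) y) = d x y" if "x \<in> B" "y \<in> B" for x y
      using g(1) fU fd that by (simp add: isometry_def)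
    show "(g \<circ> f) x = \<phi> x" if "x \<in> F" for x
      using g(2) kf that by simp
  qed
qed

lemma infinite_urysohn_space:
  assumes "urysohn_space U"
  shows "infinite (mspace U)"
proof
  assume fin: "finite (mspace U)"
  \<comment> \<open>\<open>{..n}\<close> has one point more than \<open>U\<close> would have, yet as
    a subset of the line it embeds in \<open>U\<close>.\<close>
  define n where "n = card (mspace U)"
  have M: "Metric_space {..n} (\<lambda>i j. \<bar>real i - real j\<bar>)"
    by unfold_locales auto
  obtain \<psi> where \<psi>: "\<psi> ` {..n} \<subseteq> mspace U"
    and d: "\<And>x y. \<lbrakk>x \<in> {..n}; y \<in> {..n}\<rbrakk> \<Longrightarrow> mdist U (\<psi> x) (\<psi> y) = \<bar>real x - real y\<bar>"
    using urysohn_extend_isometry[OF assms finite_atMost M, of "{}"] by auto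
  have "inj_on \<psi> {..n}"
  proof (rule inj_onI)
    fix x y assume xy: "x \<in> {..n}" "y \<in> {..n}" "\<psi> x = \<psi> y"
    moreover have "\<psi> y \<in> mspace U" using \<psi> xy(2) by blast
    ultimately have "\<bar>real x - real y\<bar> = 0" using d[OF xy(1,2)] mdist_zero by metis
    then show "x = y" by simp
  qed
  then have "card {..n} \<le> card (mspace U)" using \<psi> fin by (rule card_inj_on_le)
  then show False by (simp add: n_def)
qed

text \<open>Outside \<open>B\<close> the distance is set to 0, because \<^locale>\<open>Metric_space\<close>
  requires symmetry and nonnegativity on the whole type.\<close>

lemma metric_space_group_norm:
  assumes P: "additive_subgroup P" and N: "group_norm P N" and "B \<subseteq> P"
  shows "Metric_space B (\<lambda>x y. if x \<in> B \<and> y \<in> B then N (x - y) else 0)"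
proof -
  note nP = group_norm_props[OF P N]
  note cl = additive_subgroup_closed[OF P]
  have P': "x \<in> P" if "x \<in> B" for x using that assms(3) by blast
  have "N (x - y) = 0 \<longleftrightarrow> x = y" if "x \<in> B" "y \<in> B" for x y
  proof (cases "x = y")
    case True
    then show ?thesis using N by (simp add: group_norm_def)
  next
    case False
    then have "0 < N (x - y)"
      using N cl(2)[OF P' P', OF that] by (simp add: group_norm_def)
    then show ?thesis using False by simp
  qed
  then show ?thesis
    using P' nP by unfold_locales (auto simp: cl)
qed

section \<open>The inductive construction of the norm and the map\<close>

definition small_degree :: "nat \<Rightarrow> int poly set" where
  "small_degree n = {p. \<forall>i\<ge>n. coeff p i = 0}"

lemma additive_subgroup_small_degree: "additive_subgroup (small_degree n)"
  by (simp add: additive_subgroup_def small_degree_def)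

text \<open>The condition \<open>0 \<in> F\<close> keeps \<open>F\<close> nonempty, as
  \<open>extend_katetov\<close> demands.\<close>

definition partial_embedding ::
    "'a metric \<Rightarrow> nat \<Rightarrow> (int poly \<Rightarrow> real) \<Rightarrow> int poly set \<Rightarrow> (int poly \<Rightarrow> 'a) \<Rightarrow> bool" where
  "partial_embedding U n N F \<phi> \<longleftrightarrow>
     group_norm (small_degree n) N \<and> finite F \<and> 0 \<in> F \<and> F \<subseteq> small_degree n \<and> \<phi> ` F \<subseteq> mspace U \<and>
     (\<forall>x\<in>F. \<forall>y\<in>F. mdist U (\<phi> x) (\<phi> y) = N (x - y))"

text \<open>The new generator serves to reach \<open>v\<close>. Once the norm is fixed on the larger
  group, the finite set \<open>E\<close> is a matter of
  \<open>urysohn_extend_isometry\<close>.\<close>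

lemma extend_partial_embedding:
  assumes U: "urysohn_space U" and pe: "partial_embedding U n N F \<phi>"
    and E: "finite E" "E \<subseteq> small_degree (Suc n)" and v: "v \<in> mspace U"
  obtains N' F' \<phi>' where "partial_embedding U (Suc n) N' F' \<phi>'" "F \<subseteq> F'" "E \<subseteq> F'"
    "\<And>x. x \<in> F \<Longrightarrow> \<phi>' x = \<phi> x" "v \<in> \<phi>' ` F'"
proof -
  define P Q where "P = small_degree n" and "Q = small_degree (Suc n)"
  define g :: "int poly" where "g = monom 1 n"
  have P: "additive_subgroup P" and Q: "additive_subgroup Q"
    unfolding P_def Q_def by (rule additive_subgroup_small_degree)+
  \<comment> \<open>The coefficient of X^n is the grading \<open>\<kappa>\<close> for
    \<open>extend_group_norm\<close>.\<close>
  have PQ: "P = {x\<in>Q. coeff x n = 0}"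
  proof (intro equalityI subsetI)
    fix x assume "x \<in> {x\<in>Q. coeff x n = 0}"
    then have "coeff x i = 0" if "n \<le> i" for i
      using that by (cases "i = n") (auto simp: Q_def small_degree_def)
    then show "x \<in> P" by (simp add: P_def small_degree_def)
  qed (auto simp: P_def Q_def small_degree_def)
  have g: "g \<in> Q" "coeff g n = 1" by (auto simp: g_def Q_def small_degree_def)
  have N: "group_norm P N" and F: "finite F" "0 \<in> F" "F \<subseteq> P" and \<phi>U: "\<phi> ` F \<subseteq> mspace U"
    and \<phi>d: "\<And>x y. \<lbrakk>x \<in> F; y \<in> F\<rbrakk> \<Longrightarrow> mdist U (\<phi> x) (\<phi> y) = N (x - y)"
    using pe by (auto simp: partial_embedding_def P_def)
  obtain u where u: "u \<in> mspace U" "u \<notin> \<phi> ` F" "v \<in> insert u (\<phi> ` F)"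
  proof (cases "v \<in> \<phi> ` F")
    case True
    have "mspace U - \<phi> ` F \<noteq> {}"
      using infinite_urysohn_space[OF U] F(1) by (metis finite.emptyI finite_Diff2 finite_imageI)
    then show thesis using that True by blast
  qed (use v that in blast)
  interpret Metric_space "mspace U" "mdist U" by simp
  define f where "f x = mdist U u (\<phi> x)" for x
  have "katetov F N f"
    unfolding katetov_def
  proof (intro ballI)
    fix x y assume xy: "x \<in> F" "y \<in> F"
    have "\<phi> x \<in> mspace U" "\<phi> y \<in> mspace U" using \<phi>U xy by auto
    then show "f x \<le> f y + N (x - y) \<and> N (x - y) \<le> f x + f y"
      using triangle'[of u "\<phi> y" "\<phi> x"] triangle''[of "\<phi> x" u "\<phi> y"] \<phi>d[OF xy] u(1)
      by (simp add: f_def)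
  qed
  moreover have "0 < f x" if "x \<in> F" for x
    using that u(1,2) \<phi>U unfolding f_def by (intro mdist_pos_less) auto
  moreover have "F \<noteq> {}" using F(2) by blast
  ultimately obtain h \<delta> where h: "katetov P N h" "0 < \<delta>" "\<And>x. x \<in> P \<Longrightarrow> \<delta> \<le> h x"
    "\<And>x. x \<in> F \<Longrightarrow> h x = f x"
    using extend_katetov[OF P N F(1) _ F(3)] by blast
  obtain N' where N': "group_norm Q N'" "\<And>x. x \<in> P \<Longrightarrow> N' x = N x"
    "\<And>x. x \<in> P \<Longrightarrow> N' (g - x) = h x"
    using extend_group_norm[OF Q P PQ _ g N h(1-3)] by auto
  have gF: "g \<notin> F" using F(3) PQ g by auto
  define F0 F' where "F0 = insert g F" and "F' = F0 \<union> E"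
  define \<phi>0 where "\<phi>0 = \<phi>(g := u)"
  have F': "finite F'" "F' \<subseteq> Q" "F0 \<subseteq> F'"
    using F E g PQ by (auto simp: F'_def F0_def Q_def)
  have \<phi>0U: "\<phi>0 ` F0 \<subseteq> mspace U" using \<phi>U u(1) gF by (auto simp: \<phi>0_def F0_def)
  have N'0: "N' 0 = 0" using N' by (simp add: group_norm_def)
  have to_g: "mdist U u (\<phi> x) = N' (g - x)" if "x \<in> F" for x
    using that F(3) by (simp add: N'(3) h(4) f_def subset_iff)
  have \<phi>0d: "mdist U (\<phi>0 x) (\<phi>0 y) = N' (x - y)" if xy: "x \<in> F0" "y \<in> F0" for x y
  proof -
    have sym: "N' (x - y) = N' (y - x)"
      using xy F' by (intro group_norm_props(4)[OF Q N'(1)]) auto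
    consider "x = g" "y = g" | "x = g" "y \<in> F" | "x \<in> F" "y = g" | "x \<in> F" "y \<in> F"
      using xy by (auto simp: F0_def)
    then show ?thesis
    proof cases
      case 1
      then show ?thesis using u(1) N'0 by (simp add: \<phi>0_def)
    next
      case 2
      then show ?thesis using gF to_g by (auto simp: \<phi>0_def)
    next
      case 3
      then have "mdist U (\<phi>0 x) (\<phi>0 y) = mdist U u (\<phi> x)"
        using gF commute[of "\<phi> x" u] by (auto simp: \<phi>0_def)
      then show ?thesis using 3 to_g sym by simp
    next
      case 4
      then have "x - y \<in> P" using F(3) by (intro additive_subgroup_closed(2)[OF P]) auto
      then show ?thesis using 4 gF \<phi>d N'(2) by (auto simp: \<phi>0_def)
    qed
  qed
  define d where "d x y = (if x \<in> F' \<and> y \<in> F' then N' (x - y) else 0)" for x y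
  have "Metric_space F' d"
    using metric_space_group_norm[OF Q N'(1) F'(2)] by (simp add: d_def[abs_def])
  moreover have "mdist U (\<phi>0 x) (\<phi>0 y) = d x y" if "x \<in> F0" "y \<in> F0" for x y
    using \<phi>0d[OF that] that F'(3) by (auto simp: d_def)
  ultimately obtain \<psi> where \<psi>: "\<psi> ` F' \<subseteq> mspace U"
    "\<And>x y. \<lbrakk>x \<in> F'; y \<in> F'\<rbrakk> \<Longrightarrow> mdist U (\<psi> x) (\<psi> y) = d x y" "\<And>x. x \<in> F0 \<Longrightarrow> \<psi> x = \<phi>0 x"
    using urysohn_extend_isometry[OF U F'(1) _ F'(3) \<phi>0U] by metis
  have old: "\<psi> x = \<phi> x" if "x \<in> F" for x
    using \<psi>(3)[of x] that gF by (auto simp: \<phi>0_def F0_def)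
  have "\<psi> g = u" using \<psi>(3)[of g] by (simp add: \<phi>0_def F0_def)
  moreover have "\<phi> ` F = \<psi> ` F" using old by simp
  ultimately have "v \<in> \<psi> ` F'"
    using u(3) by (auto simp: F'_def F0_def)
  moreover have "partial_embedding U (Suc n) N' F' \<psi>"
    using N'(1) F' F(2) \<psi>(1,2) by (auto simp: partial_embedding_def Q_def F0_def d_def)
  ultimately show thesis
    using that old by (auto simp: F'_def F0_def)
qed

text \<open>Stage \<open>n\<close> puts \<open>v n\<close> into the image and \<open>E n\<close>
  into the domain. As \<open>v\<close> runs through a dense set and the \<open>E n\<close> exhaust
  all polynomials, the union of the stages is total with dense image.\<close>

lemma urysohn_dense_invariant_map:
  assumes U: "urysohn_space U"
  obtains \<phi> :: "int poly \<Rightarrow> 'a" where "dense_invariant_map (U :: 'a metric) \<phi>" "inj \<phi>"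
proof -
  interpret Metric_space "mspace U" "mdist U" by simp
  have "mspace U \<noteq> {}" using infinite_urysohn_space[OF U] by auto
  then obtain u0 where u0: "u0 \<in> mspace U" by blast
  obtain D where D: "countable D" "D \<subseteq> mspace U" and dense: "mspace U \<subseteq> mtopology closure_of D"
    using U by (auto simp: urysohn_space_def polish_metric_def separable_space_def mtopology_of_def)
  have "D \<noteq> {}" using dense u0 by auto
  define v where "v = from_nat_into D"
  have vU: "v n \<in> mspace U" for n
    using from_nat_into[OF \<open>D \<noteq> {}\<close>] D(2) by (auto simp: v_def)
  have v_surj: "\<exists>n. v n = x" if "x \<in> D" for x
    using D(1) that unfolding v_def by (metis from_nat_into_surj)
  \<comment> \<open>Every polynomial comes from its coefficient list, and integer lists are
    countable.\<close>
  define e :: "nat \<Rightarrow> int poly" where "e n = Poly (from_nat n)" for n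
  have e_surj: "\<exists>n. e n = p" for p
    by (rule exI[of _ "to_nat (coeffs p)"]) (simp add: e_def)
  define E where "E n = e ` {..n} \<inter> small_degree (Suc n)" for n
  define good where "good n s = (case s of (N, F, \<phi>) \<Rightarrow> partial_embedding U n N F \<phi>)" for n s
  define next_stage where "next_stage n s s' =
     (case s of (N, F, \<phi>) \<Rightarrow> case s' of (N' :: int poly \<Rightarrow> real, F', \<phi>') \<Rightarrow>
       F \<subseteq> F' \<and> E n \<subseteq> F' \<and> (\<forall>x\<in>F. \<phi>' x = \<phi> x) \<and> v n \<in> \<phi>' ` F')"
    for n and s s' :: "(int poly \<Rightarrow> real) \<times> int poly set \<times> (int poly \<Rightarrow> 'a)"
  have "\<exists>S. \<forall>n. good n (S n) \<and> next_stage n (S n) (S (Suc n))"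
  proof (rule dependent_nat_choice)
    \<comment> \<open>\<open>small_degree 0\<close> is the zero group, so the induction starts with
      the zero norm and a single point.\<close>
    have "p = 0" if "p \<in> small_degree 0" for p
      using that by (simp add: small_degree_def poly_eq_iff)
    then have "good 0 (\<lambda>_. 0, {0}, \<lambda>_. u0)"
      using u0 by (auto simp: good_def partial_embedding_def group_norm_def small_degree_def)
    then show "\<exists>s. good 0 s" by blast
  next
    fix s n assume "good n s"
    then obtain N F \<phi> where s: "s = (N, F, \<phi>)" "partial_embedding U n N F \<phi>"
      by (auto simp: good_def split: prod.splits)
    have "finite (E n)" "E n \<subseteq> small_degree (Suc n)" by (auto simp: E_def)
    then obtain N' F' \<phi>' where "partial_embedding U (Suc n) N' F' \<phi>'" "F \<subseteq> F'" "E n \<subseteq> F'"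
      "\<And>x. x \<in> F \<Longrightarrow> \<phi>' x = \<phi> x" "v n \<in> \<phi>' ` F'"
      using extend_partial_embedding[OF U s(2) _ _ vU] by blast
    then have "good (Suc n) (N', F', \<phi>') \<and> next_stage n s (N', F', \<phi>')"
      by (simp add: good_def next_stage_def s(1))
    then show "\<exists>s'. good (Suc n) s' \<and> next_stage n s s'" by blast
  qed
  then obtain S where S: "\<And>n. good n (S n)" "\<And>n. next_stage n (S n) (S (Suc n))" by blast
  define N F \<Phi> where "N n = fst (S n)" and "F n = fst (snd (S n))" and "\<Phi> n = snd (snd (S n))" for n
  have pe: "partial_embedding U n (N n) (F n) (\<Phi> n)" for n
    using S(1)[of n] by (simp add: good_def N_def F_def \<Phi>_def split: prod.splits)
  have step: "F n \<subseteq> F (Suc n)" "E n \<subseteq> F (Suc n)" "v n \<in> \<Phi> (Suc n) ` F (Suc n)"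
    and \<Phi>_step: "x \<in> F n \<Longrightarrow> \<Phi> (Suc n) x = \<Phi> n x" for n x
    using S(2)[of n] by (auto simp: next_stage_def F_def \<Phi>_def split: prod.splits)
  have F_mono: "F m \<subseteq> F n" if "m \<le> n" for m n
    using that step(1) by (rule lift_Suc_mono_le[of F, rotated])
  have \<Phi>_eq: "\<Phi> n x = \<Phi> m x" if "m \<le> n" "x \<in> F m" for m n x
    using that(1)
  proof (induction n rule: dec_induct)
    case (step n)
    have "x \<in> F n" using F_mono[OF step(1)] that(2) by blast
    then show ?case using \<Phi>_step step(3) by simp
  qed simp
  have exhaust: "\<exists>n. p \<in> F n" for p
  proof -
    obtain k where k: "e k = p" using e_surj by blast
    define n where "n = max k (degree p)"
    have "p \<in> small_degree (Suc n)"
      by (auto simp: small_degree_def n_def coeff_eq_0)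
    then have "p \<in> E n" using k by (auto simp: E_def n_def)
    then show ?thesis using step(2) by blast
  qed
  \<comment> \<open>Later stages agree with the first one at which \<open>p\<close> appears, by
    \<open>\<Phi>_eq\<close>.\<close>
  define \<phi> where "\<phi> p = \<Phi> (LEAST n. p \<in> F n) p" for p
  have \<phi>_eq: "\<phi> p = \<Phi> n p" if "p \<in> F n" for p n
    using that unfolding \<phi>_def by (metis LeastI Least_le \<Phi>_eq)
  have common: "\<exists>n. A \<subseteq> F n" if "finite A" for A
    using that
  proof induction
    case (insert p A)
    then obtain m n where "A \<subseteq> F m" "p \<in> F n" using exhaust by blast
    then have "insert p A \<subseteq> F (max m n)" using F_mono[of m "max m n"] F_mono[of n "max m n"] by auto
    then show ?case by blast
  qed simp
  have \<phi>U: "\<phi> p \<in> mspace U" for p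
  proof -
    obtain n where n: "p \<in> F n" using exhaust by blast
    then show ?thesis using pe[of n] \<phi>_eq[OF n] by (auto simp: partial_embedding_def)
  qed
  have dist: "mdist U (\<phi> x) (\<phi> y) = N n (x - y)" if "x \<in> F n" "y \<in> F n" for n x y
    using pe[of n] that \<phi>_eq by (simp add: partial_embedding_def)
  have "dense_invariant_map U \<phi>"
  proof
    show "mcomplete_of U" using U by (simp add: urysohn_space_def polish_metric_def)
    show "\<phi> x \<in> mspace U" for x by (rule \<phi>U)
    show "mdist U (\<phi> (x + z)) (\<phi> (y + z)) = mdist U (\<phi> x) (\<phi> y)" for x y z
    proof -
      \<comment> \<open>With all four points in one \<open>F n\<close>, both distances are values of
        the same norm \<open>N n\<close> at the same difference.\<close>
      obtain n where "{x, y, x + z, y + z} \<subseteq> F n" using common[of "{x, y, x + z, y + z}"] by auto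
      then show ?thesis by (simp add: dist[of _ n])
    qed
    fix u r assume "u \<in> mspace U" "0 < (r::real)"
    then obtain w where w: "w \<in> D" "w \<in> mball u r"
      using dense by (force simp: metric_closure_of)
    then obtain n where n: "v n = w" using v_surj by blast
    then obtain x where "x \<in> F (Suc n)" "w = \<Phi> (Suc n) x" using step(3)[of n] by auto
    then have "\<phi> x = w" using \<phi>_eq by simp
    then show "\<exists>x. mdist U (\<phi> x) u < r" using w by (auto simp: commute)
  qed
  moreover have "inj \<phi>"
  proof (rule injI)
    fix x y assume eq: "\<phi> x = \<phi> y"
    obtain n where n: "{x, y} \<subseteq> F n" using common[of "{x, y}"] by auto
    have FP: "F n \<subseteq> small_degree n" and Nn: "group_norm (small_degree n) (N n)"
      using pe[of n] by (auto simp: partial_embedding_def)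
    \<comment> \<open>Injectivity comes from the strict positivity of the norm away from 0.\<close>
    have "N n (x - y) = 0" using dist[of x n y] n eq \<phi>U by (simp add: mdist_zero)
    then show "x = y"
      using Metric_space.zero[OF metric_space_group_norm[OF additive_subgroup_small_degree Nn FP]] n
      by auto
  qed
  ultimately show thesis by (rule that)
qed

theorem proposition5:
  fixes U :: "'a metric"
  assumes "urysohn_space U"
  shows "\<exists>H. subgroup H (isometry_group U)
    \<and> comm_group (isometry_group U \<lparr>carrier := H\<rparr>)
    \<and> infinite_exponent (isometry_group U \<lparr>carrier := H\<rparr>)
    \<and> transitive_action (isometry_group U \<lparr>carrier := H\<rparr>) (mspace U) (\<lambda>h. h)"
proof -
  obtain \<phi> :: "int poly \<Rightarrow> 'a" where "dense_invariant_map U \<phi>" and inj: "inj \<phi>"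
    using urysohn_dense_invariant_map[OF assms] .
  then interpret dense_invariant_map U \<phi> by simp
  \<comment> \<open>The multiples of the constant polynomial 1 are nonzero, because integer
    polynomials have characteristic 0.\<close>
  have "((+) a ^^ n) 0 = of_nat n * a" for n and a :: "int poly"
    by (induction n) (auto simp: algebra_simps)
  then have "\<exists>a::int poly. ((+) a ^^ n) 0 \<noteq> 0" if "0 < n" for n
    using that by (intro exI[of _ 1]) simp
  then show ?thesis
    using subgroup_translations comm_group_translations transitive_translations
      infinite_exponent_translations[OF inj] by blast
qed

end
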